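(* Let $m,n$ be non-zero integers, and let $T_{m,n}$ be the Bass-Serre tree of $\mathrm{BS}(m,n)$. Then the closure of (the image of) $\mathrm{BS}(m,n)$ in $\mathrm{Aut}(T_{m,n})$ coincides with $G_{m,n}$.
   Context: For non-zero integers $m,n$, $\mathrm{BS}(m,n)=\langle a,t\mid ta^mt^{-1}=a^n\rangle$. The Bass-Serre tree $T_{m,n}$ has as vertices the left cosets of $\langle a\rangle$ in $\mathrm{BS}(m,n)$, with $(u\langle a\rangle, v\langle a\rangle)$ an edge labelled $t^{\pm1}$ if $v\langle a\rangle=ua^it^{\pm1}\langle a\rangle$ for some $i\in\mathbb{Z}$ (an edge labelled $t^{-1}$ is the reverse of an edge labelled $t$). $\mathrm{BS}(m,n)$ acts on $T_{m,n}$ by left multiplication. Since vertices are cosets, $\mathrm{Aut}(T_{m,n})\subseteq\mathrm{Sym}(\mathrm{BS}(m,n)/\langle a\rangle)$. $\mathrm{Aut}(T_{m,n})$ has the topology with basis the sets $N(x,F)=\{\beta\in\mathrm{Aut}(T_{m,n})\mid \beta.v=x.v\ \forall v\in F\}$, $F$ a finite set of vertices. Let $\pi:\mathrm{BS}(m,n)\to \mathrm{Sym}(\mathrm{BS}(m,n)/\langle a\rangle)$ be the left multiplication action on cosets; give $\mathrm{Sym}(\mathrm{BS}(m,n)/\langle a\rangle)$ the topology of pointwise convergence, with basis the sets $\mathcal N(x,F)=\{y\mid y(c)=x(c)\ \forall c\in F\}$, $F$ a finite set of cosets. $G_{m,n}$ is the closure of the image of $\pi$ in $\mathrm{Sym}(\mathrm{BS}(m,n)/\langle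 a\rangle)$, with the subspace topology. *)

theory Defs
  imports "HOL-Analysis.Analysis" "HOL-Algebra.Generated_Groups"
    "HOL-Algebra.Left_Coset" "HOL-Algebra.Bij"
begin

section \<open>Groups given by generators and relations\<close>

text \<open>The letter \<open>(x, True)\<close> stands for the generator \<open>x\<close> and \<open>(x, False)\<close> for its
  formal inverse. The generating set is the whole type \<open>'g\<close>.\<close>

type_synonym 'g word = "('g \<times> bool) list"

text \<open>A set \<open>R\<close> of pairs of words is read as a set of defining equations. The relation below is
  the least congruence on words that cancels inverse letters and satisfies them.\<close>

inductive pres_eq :: "('g word \<times> 'g word) set \<Rightarrow> 'g word \<Rightarrow> 'g word \<Rightarrow> bool"
  for R :: "('g word \<times> 'g word) set" where
  pres_refl: "pres_eq R u u"
| pres_sym: "pres_eq R u v \<Longrightarrow> pres_eq R v u"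
| pres_trans: "pres_eq R u v \<Longrightarrow> pres_eq R v w \<Longrightarrow> pres_eq R u w"
| pres_cancel: "pres_eq R (u @ [(x, b), (x, \<not> b)] @ v) (u @ v)"
| pres_relation: "(l, r) \<in> R \<Longrightarrow> pres_eq R (u @ l @ v) (u @ r @ v)"

definition pres_rel :: "('g word \<times> 'g word) set \<Rightarrow> ('g word \<times> 'g word) set" where
  "pres_rel R = {(u, v). pres_eq R u v}"

definition presented_group :: "('g word \<times> 'g word) set \<Rightarrow> 'g word set monoid" where
  "presented_group R =
    \<lparr>carrier = UNIV // pres_rel R,
     mult = (\<lambda>A B. \<Union>u\<in>A. \<Union>v\<in>B. pres_rel R `` {u @ v}),
     one = pres_rel R `` {[]}\<rparr>"

definition gen_elem :: "('g word \<times> 'g word) set \<Rightarrow> 'g \<Rightarrow> 'g word set" where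
  "gen_elem R x = pres_rel R `` {[(x, True)]}"

definition gen_power :: "'g \<Rightarrow> int \<Rightarrow> 'g word" where
  "gen_power x k = replicate (nat \<bar>k\<bar>) (x, 0 \<le> k)"

lemma equiv_pres_rel: "equiv UNIV (pres_rel R)"
  by (rule equivI)
    (auto simp: pres_rel_def refl_on_def sym_def trans_def intro: pres_eq.intros)

lemma pres_eq_append_left: "pres_eq R u v \<Longrightarrow> pres_eq R (w @ u) (w @ v)"
proof (induction rule: pres_eq.induct)
  case (pres_cancel u x b v)
  show ?case using pres_eq.pres_cancel[of R "w @ u" x b v] by simp
next
  case (pres_relation l r u v)
  then show ?case using pres_eq.pres_relation[of l r R "w @ u" v] by simp
qed (auto intro: pres_eq.intros)

lemma pres_eq_append_right: "pres_eq R u v \<Longrightarrow> pres_eq R (u @ w) (v @ w)"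
proof (induction rule: pres_eq.induct)
  case (pres_cancel u x b v)
  show ?case using pres_eq.pres_cancel[of R u x b "v @ w"] by simp
next
  case (pres_relation l r u v)
  then show ?case using pres_eq.pres_relation[of l r R u "v @ w"] by simp
qed (auto intro: pres_eq.intros)

lemma pres_eq_append: "pres_eq R u u' \<Longrightarrow> pres_eq R v v' \<Longrightarrow> pres_eq R (u @ v) (u' @ v')"
  by (meson pres_eq_append_left pres_eq_append_right pres_trans)

lemma presented_mult_class:
  "mult (presented_group R) (pres_rel R `` {u}) (pres_rel R `` {v}) = pres_rel R `` {u @ v}"
proof -
  have "pres_rel R `` {u' @ v'} = pres_rel R `` {u @ v}"
    if "pres_eq R u u'" "pres_eq R v v'" for u' v'
    using equiv_class_eq[OF equiv_pres_rel, of "u @ v" "u' @ v'" R]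
      pres_eq_append[OF that] by (simp add: pres_rel_def)
  then have "(\<Union>u'\<in>pres_rel R `` {u}. \<Union>v'\<in>pres_rel R `` {v}. pres_rel R `` {u' @ v'})
      = (\<Union>u'\<in>pres_rel R `` {u}. \<Union>v'\<in>pres_rel R `` {v}. pres_rel R `` {u @ v})"
    by (intro SUP_cong refl) (simp add: pres_rel_def)
  also have "\<dots> = pres_rel R `` {u @ v}"
    using equiv_class_self[OF equiv_pres_rel, of u R]
      equiv_class_self[OF equiv_pres_rel, of v R] by blast
  finally show ?thesis by (simp add: presented_group_def)
qed

lemma pres_eq_inverse: "pres_eq R (rev (map (\<lambda>(x, b). (x, \<not> b)) u) @ u) []"
proof (induction u)
  case Nil
  then show ?case by (simp add: pres_refl)
next
  case (Cons p u)
  obtain x b where p: "p = (x, b)" by fastforce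
  show ?case
    using pres_cancel[of R "rev (map (\<lambda>(x, b). (x, \<not> b)) u)" x "\<not> b" u] Cons.IH
    by (auto simp: p intro: pres_trans)
qed

theorem group_presented_group: "group (presented_group R)"
proof (rule groupI)
  let ?G = "presented_group R"
  have cl: "pres_rel R `` {u} \<in> carrier ?G" for u
    by (simp add: presented_group_def quotientI)
  have ex: "\<exists>u. A = pres_rel R `` {u}" if "A \<in> carrier ?G" for A
    using that by (auto simp: presented_group_def elim: quotientE)
  have one: "\<one>\<^bsub>?G\<^esub> = pres_rel R `` {[]}" by (simp add: presented_group_def)
  show "A \<otimes>\<^bsub>?G\<^esub> B \<in> carrier ?G" if "A \<in> carrier ?G" "B \<in> carrier ?G" for A B
    using ex[OF that(1)] ex[OF that(2)] by (auto simp: presented_mult_class cl)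
  show "\<one>\<^bsub>?G\<^esub> \<in> carrier ?G" by (simp add: one cl)
  show "A \<otimes>\<^bsub>?G\<^esub> B \<otimes>\<^bsub>?G\<^esub> C = A \<otimes>\<^bsub>?G\<^esub> (B \<otimes>\<^bsub>?G\<^esub> C)"
    if "A \<in> carrier ?G" "B \<in> carrier ?G" "C \<in> carrier ?G" for A B C
    using ex[OF that(1)] ex[OF that(2)] ex[OF that(3)] by (auto simp: presented_mult_class)
  show "\<one>\<^bsub>?G\<^esub> \<otimes>\<^bsub>?G\<^esub> A = A" if "A \<in> carrier ?G" for A
    using ex[OF that] by (auto simp: presented_mult_class one)
  show "\<exists>B\<in>carrier ?G. B \<otimes>\<^bsub>?G\<^esub> A = \<one>\<^bsub>?G\<^esub>" if A: "A \<in> carrier ?G" for A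
  proof -
    obtain u where u: "A = pres_rel R `` {u}" using ex[OF A] by blast
    have "pres_rel R `` {rev (map (\<lambda>(x, b). (x, \<not> b)) u) @ u} = pres_rel R `` {[]}"
      using equiv_class_eq[OF equiv_pres_rel, of _ "[]" R] pres_eq_inverse[of R u]
      by (simp add: pres_rel_def)
    then show ?thesis
      by (intro bexI[OF _ cl[of "rev (map (\<lambda>(x, b). (x, \<not> b)) u)"]])
        (simp add: u one presented_mult_class)
  qed
qed


section \<open>Baumslag-Solitar groups\<close>

datatype bs_gen = Gen_a | Gen_t

definition bs_relations :: "int \<Rightarrow> int \<Rightarrow> (bs_gen word \<times> bs_gen word) set" where
  "bs_relations m n =
    {([(Gen_t, True)] @ gen_power Gen_a m @ [(Gen_t, False)], gen_power Gen_a n)}"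

definition BS :: "int \<Rightarrow> int \<Rightarrow> bs_gen word set monoid" where
  "BS m n = presented_group (bs_relations m n)"

definition bs_a :: "int \<Rightarrow> int \<Rightarrow> bs_gen word set" where
  "bs_a m n = gen_elem (bs_relations m n) Gen_a"

definition bs_t :: "int \<Rightarrow> int \<Rightarrow> bs_gen word set" where
  "bs_t m n = gen_elem (bs_relations m n) Gen_t"

definition bs_A :: "int \<Rightarrow> int \<Rightarrow> bs_gen word set set" where
  "bs_A m n = generate (BS m n) {bs_a m n}"

lemma group_BS: "group (BS m n)"
  by (simp add: BS_def group_presented_group)

lemma bs_a_carrier: "bs_a m n \<in> carrier (BS m n)"
  by (simp add: bs_a_def BS_def gen_elem_def presented_group_def quotientI)

lemma bs_t_carrier: "bs_t m n \<in> carrier (BS m n)"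
  by (simp add: bs_t_def BS_def gen_elem_def presented_group_def quotientI)

lemma subgroup_bs_A: "subgroup (bs_A m n) (BS m n)"
  unfolding bs_A_def
  by (rule group.generate_is_subgroup[OF group_BS]) (simp add: bs_a_carrier)


section \<open>The Bass-Serre tree and its automorphisms\<close>

type_synonym bs_coset = "bs_gen word set set"

definition bs_vertices :: "int \<Rightarrow> int \<Rightarrow> bs_coset set" where
  "bs_vertices m n = lcosets\<^bsub>BS m n\<^esub> (bs_A m n)"

text \<open>An edge \<open>(C, e, D)\<close> goes from \<open>C\<close> to \<open>D\<close> and carries the label \<open>t [^] e\<close>.\<close>

definition bs_edges :: "int \<Rightarrow> int \<Rightarrow> (bs_coset \<times> int \<times> bs_coset) set" where
  "bs_edges m n =
    {(u <#\<^bsub>BS m n\<^esub> bs_A m n, e, v <#\<^bsub>BS m n\<^esub> bs_A m n) | u v e.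
       u \<in> carrier (BS m n) \<and> v \<in> carrier (BS m n) \<and> e \<in> {1, -1} \<and>
       (\<exists>i::int. v <#\<^bsub>BS m n\<^esub> bs_A m n =
          (u \<otimes>\<^bsub>BS m n\<^esub> (bs_a m n [^]\<^bsub>BS m n\<^esub> i) \<otimes>\<^bsub>BS m n\<^esub> (bs_t m n [^]\<^bsub>BS m n\<^esub> e))
            <#\<^bsub>BS m n\<^esub> bs_A m n)}"

definition bs_adj :: "int \<Rightarrow> int \<Rightarrow> bs_coset \<Rightarrow> bs_coset \<Rightarrow> bool" where
  "bs_adj m n C D \<longleftrightarrow> (\<exists>e. (C, e, D) \<in> bs_edges m n)"

text \<open>The edge labels may or may not be counted as part of the structure of the tree, which gives
  two automorphism groups: the first ignores the labels, the second preserves them.\<close>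

definition bs_tree_Aut :: "int \<Rightarrow> int \<Rightarrow> (bs_coset \<Rightarrow> bs_coset) set" where
  "bs_tree_Aut m n =
    {f \<in> Bij (bs_vertices m n).
       \<forall>C\<in>bs_vertices m n. \<forall>D\<in>bs_vertices m n. bs_adj m n (f C) (f D) \<longleftrightarrow> bs_adj m n C D}"

definition bs_tree_label_Aut :: "int \<Rightarrow> int \<Rightarrow> (bs_coset \<Rightarrow> bs_coset) set" where
  "bs_tree_label_Aut m n =
    {f \<in> Bij (bs_vertices m n).
       \<forall>C\<in>bs_vertices m n. \<forall>D\<in>bs_vertices m n. \<forall>e.
         (f C, e, f D) \<in> bs_edges m n \<longleftrightarrow> (C, e, D) \<in> bs_edges m n}"


section \<open>The pointwise topology on a set of permutations\<close>

definition agree_nbhd :: "('a \<Rightarrow> 'a) set \<Rightarrow> ('a \<Rightarrow> 'a) \<Rightarrow> 'a set \<Rightarrow> ('a \<Rightarrow> 'a) set" where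
  "agree_nbhd P x F = {y \<in> P. \<forall>c\<in>F. y c = x c}"

definition perm_topology :: "'a set \<Rightarrow> ('a \<Rightarrow> 'a) set \<Rightarrow> ('a \<Rightarrow> 'a) topology" where
  "perm_topology X P =
    topology_generated_by {agree_nbhd P x F | x F. x \<in> P \<and> finite F \<and> F \<subseteq> X}"

text \<open>The generating sets form a basis, not merely a subbasis.\<close>

lemma openin_perm_topology:
  "openin (perm_topology X P) U \<longleftrightarrow>
    U \<subseteq> P \<and> (\<forall>x\<in>U. \<exists>F. finite F \<and> F \<subseteq> X \<and> agree_nbhd P x F \<subseteq> U)"
  (is "_ \<longleftrightarrow> ?R U")
proof
  let ?B = "{agree_nbhd P x F | x F. x \<in> P \<and> finite F \<and> F \<subseteq> X}"
  assume "openin (perm_topology X P) U"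
  then have "generate_topology_on ?B U"
    by (simp add: perm_topology_def openin_topology_generated_by_iff)
  then show "?R U"
  proof induction
    case Empty
    then show ?case by simp
  next
    case (Int a b)
    show ?case
    proof (intro conjI ballI)
      show "a \<inter> b \<subseteq> P" using Int.IH by blast
      fix x assume "x \<in> a \<inter> b"
      then obtain F F' where "finite F" "F \<subseteq> X" "agree_nbhd P x F \<subseteq> a"
        "finite F'" "F' \<subseteq> X" "agree_nbhd P x F' \<subseteq> b"
        using Int.IH by blast
      then show "\<exists>F. finite F \<and> F \<subseteq> X \<and> agree_nbhd P x F \<subseteq> a \<inter> b"
        by (intro exI[of _ "F \<union> F'"]) (auto simp: agree_nbhd_def)
    qed
  next
    case (UN K)
    show ?case
    proof (intro conjI ballI)
      show "\<Union>K \<subseteq> P" using UN.IH by (intro Union_least) simp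
      fix x assume "x \<in> \<Union>K"
      then obtain k where "k \<in> K" "x \<in> k" by blast
      moreover obtain F where "finite F" "F \<subseteq> X" "agree_nbhd P x F \<subseteq> k"
        using UN.IH[OF \<open>k \<in> K\<close>] \<open>x \<in> k\<close> by auto
      ultimately show "\<exists>F. finite F \<and> F \<subseteq> X \<and> agree_nbhd P x F \<subseteq> \<Union>K"
        by (intro exI[of _ F]) auto
    qed
  next
    case (Basis s)
    then obtain y F where s: "s = agree_nbhd P y F" "finite F" "F \<subseteq> X" by blast
    have "agree_nbhd P x F \<subseteq> s" if "x \<in> s" for x
      using that by (auto simp: s agree_nbhd_def)
    moreover have "s \<subseteq> P" by (auto simp: s agree_nbhd_def)
    ultimately show ?case using s(2,3) by (intro conjI ballI exI[of _ F]) simp_all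
  qed
next
  assume R: "?R U"
  have "\<exists>W. openin (perm_topology X P) W \<and> x \<in> W \<and> W \<subseteq> U" if x: "x \<in> U" for x
  proof -
    obtain F where F: "finite F" "F \<subseteq> X" "agree_nbhd P x F \<subseteq> U" using R x by blast
    have "openin (perm_topology X P) (agree_nbhd P x F)"
      unfolding perm_topology_def
    proof (intro topology_generated_by_Basis CollectI exI conjI)
      show "x \<in> P" using R x by auto
    qed (use F in simp_all)
    moreover have "x \<in> agree_nbhd P x F" using R x by (auto simp: agree_nbhd_def)
    ultimately show ?thesis using F by blast
  qed
  then show "openin (perm_topology X P) U"
    by (intro iffD2[OF openin_subopen]) blast
qed

lemma topspace_perm_topology: "topspace (perm_topology X P) = P"
proof
  show "topspace (perm_topology X P) \<subseteq> P"
    by (rule conjunct1[OF iffD1[OF openin_perm_topology openin_topspace]])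
  have "openin (perm_topology X P) P"
    unfolding openin_perm_topology
    by (intro conjI ballI exI[of _ "{}"]) (simp_all add: agree_nbhd_def)
  then show "P \<subseteq> topspace (perm_topology X P)" by (rule openin_subset)
qed


section \<open>The closure of a Baumslag-Solitar group\<close>

definition bs_Sym_topology :: "int \<Rightarrow> int \<Rightarrow> (bs_coset \<Rightarrow> bs_coset) topology" where
  "bs_Sym_topology m n = perm_topology (bs_vertices m n) (Bij (bs_vertices m n))"

definition bs_pi :: "int \<Rightarrow> int \<Rightarrow> bs_gen word set \<Rightarrow> bs_coset \<Rightarrow> bs_coset" where
  "bs_pi m n g = (\<lambda>C\<in>bs_vertices m n. g <#\<^bsub>BS m n\<^esub> C)"

definition bs_image :: "int \<Rightarrow> int \<Rightarrow> (bs_coset \<Rightarrow> bs_coset) set" where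
  "bs_image m n = bs_pi m n ` carrier (BS m n)"

definition bs_G :: "int \<Rightarrow> int \<Rightarrow> (bs_coset \<Rightarrow> bs_coset) set" where
  "bs_G m n = bs_Sym_topology m n closure_of bs_image m n"

definition bs_G_topology :: "int \<Rightarrow> int \<Rightarrow> (bs_coset \<Rightarrow> bs_coset) topology" where
  "bs_G_topology m n = subtopology (bs_Sym_topology m n) (bs_G m n)"

end

theory Submission
  imports Defs
begin

text \<open>Being an automorphism of a graph is a condition on pairs of vertices: \<open>f\<close> must preserve and
  reflect each edge relation at each pair \<open>(C, D)\<close>. A permutation in the pointwise closure of
  a set of automorphisms agrees with one of them on \<open>{C, D}\<close>, so it satisfies the condition as
  well (\<open>closure_of_preserves\<close>). Hence the closure of the Baumslag-Solitar group in the full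
  symmetric group already lies in the automorphism group. The pointwise topology on the
  automorphism group is the one induced from the symmetric group (\<open>perm_topology_mono\<close>), so
  closing up inside either group gives the same set with the same topology
  (\<open>closure_perm_topology_eq\<close>).

  What remains is that left multiplication acts by automorphisms. It preserves the edges with
  their labels because an edge is described by right multiplication by \<open>a\<^sup>i t\<^sup>\<plusminus>\<^sup>1\<close>, and it
  reflects them because left multiplication by the inverse preserves them too. The argument only
  involves relations invariant under the action, so it treats the labelled and the unlabelled
  automorphism group alike.\<close>

section \<open>Pointwise closures\<close>

lemma perm_topology_mono:
  assumes "Q \<subseteq> P"
  shows "perm_topology X Q = subtopology (perm_topology X P) Q"
proof (rule iffD2[OF topology_eq], intro allI iffI)
  fix U assume "openin (perm_topology X Q) U"
  then have U: "U \<subseteq> Q" "\<And>x. x \<in> U \<Longrightarrow> \<exists>F. finite F \<and> F \<subseteq> X \<and> agree_nbhd Q x F \<subseteq> U"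
    by (auto simp: openin_perm_topology)
  \<comment> \<open>This is the largest open subset of \<open>P\<close> that meets \<open>Q\<close> only inside \<open>U\<close>.\<close>
  define V where
    "V = {y \<in> P. \<exists>F. finite F \<and> F \<subseteq> X \<and> agree_nbhd Q y F \<subseteq> U}"
  have "openin (perm_topology X P) V"
    unfolding openin_perm_topology
  proof (intro conjI ballI)
    show "V \<subseteq> P" by (auto simp: V_def)
    fix y assume "y \<in> V"
    then obtain F where F: "finite F" "F \<subseteq> X" "agree_nbhd Q y F \<subseteq> U"
      by (auto simp: V_def)
    have "agree_nbhd Q z F \<subseteq> U" if "z \<in> agree_nbhd P y F" for z
      using that F(3) by (auto simp: agree_nbhd_def)
    moreover have "agree_nbhd P y F \<subseteq> P" by (auto simp: agree_nbhd_def)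
    ultimately have "agree_nbhd P y F \<subseteq> V"
      using F(1,2) unfolding V_def by blast
    then show "\<exists>F. finite F \<and> F \<subseteq> X \<and> agree_nbhd P y F \<subseteq> V"
      using F(1,2) by blast
  qed
  moreover have "U = V \<inter> Q"
  proof
    show "U \<subseteq> V \<inter> Q" using U assms by (auto simp: V_def)
    show "V \<inter> Q \<subseteq> U" by (auto simp: V_def agree_nbhd_def)
  qed
  ultimately show "openin (subtopology (perm_topology X P) Q) U"
    by (auto simp: openin_subtopology)
next
  fix U assume "openin (subtopology (perm_topology X P) Q) U"
  then obtain V where V: "openin (perm_topology X P) V" "U = V \<inter> Q"
    by (auto simp: openin_subtopology)
  show "openin (perm_topology X Q) U"
    unfolding openin_perm_topology
  proof (intro conjI ballI)
    show "U \<subseteq> Q" using V(2) by blast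
    fix x assume x: "x \<in> U"
    then obtain F where F: "finite F" "F \<subseteq> X" "agree_nbhd P x F \<subseteq> V"
      using V by (auto simp: openin_perm_topology)
    have "agree_nbhd Q x F \<subseteq> agree_nbhd P x F \<inter> Q"
      using assms by (auto simp: agree_nbhd_def)
    then show "\<exists>F. finite F \<and> F \<subseteq> X \<and> agree_nbhd Q x F \<subseteq> U"
      using F V(2) by blast
  qed
qed

lemma closure_of_perm_topologyD:
  assumes f: "f \<in> perm_topology X P closure_of S" and F: "finite F" "F \<subseteq> X"
  obtains g where "g \<in> S" "\<And>c. c \<in> F \<Longrightarrow> g c = f c"
proof -
  have fP: "f \<in> P"
    using f by (simp add: in_closure_of topspace_perm_topology)
  have "openin (perm_topology X P) (agree_nbhd P f F)"
    using fP F unfolding perm_topology_def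
    by (intro topology_generated_by_Basis) blast
  moreover have "f \<in> agree_nbhd P f F"
    using fP by (simp add: agree_nbhd_def)
  ultimately obtain g where "g \<in> S" "g \<in> agree_nbhd P f F"
    using f unfolding in_closure_of by blast
  then show ?thesis
    by (intro that[of g]) (auto simp: agree_nbhd_def)
qed

text \<open>The condition on \<open>f\<close> at a pair of points only sees the two values of \<open>f\<close> there, and these
  are values of a member of \<open>S\<close>.\<close>

lemma closure_of_preserves:
  assumes f: "f \<in> perm_topology X P closure_of S"
    and S: "\<And>g C D. g \<in> S \<Longrightarrow> C \<in> X \<Longrightarrow> D \<in> X \<Longrightarrow> E (g C) (g D) \<longleftrightarrow> E C D"
    and CD: "C \<in> X" "D \<in> X"
  shows "E (f C) (f D) \<longleftrightarrow> E C D"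
proof -
  obtain g where "g \<in> S" "\<And>c. c \<in> {C, D} \<Longrightarrow> g c = f c"
    using closure_of_perm_topologyD[OF f, of "{C, D}"] CD by auto
  then show ?thesis using S[of g C D] CD by simp
qed

lemma closure_perm_topology_eq:
  assumes "Q \<subseteq> P" "perm_topology X P closure_of S \<subseteq> Q" "S \<subseteq> Q"
  shows "perm_topology X Q closure_of S = perm_topology X P closure_of S"
    and "subtopology (perm_topology X Q) (perm_topology X P closure_of S) =
      subtopology (perm_topology X P) (perm_topology X P closure_of S)"
  using assms
  by (simp_all add: perm_topology_mono[OF assms(1)] closure_of_subtopology
      subtopology_subtopology Int_absorb1)


section \<open>The action on the Bass-Serre tree\<close>

lemma bs_vertices_iff:
  "C \<in> bs_vertices m n \<longleftrightarrow>
    (\<exists>u\<in>carrier (BS m n). C = u <#\<^bsub>BS m n\<^esub> bs_A m n)"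
  by (auto simp: bs_vertices_def LCOSETS_def)

lemma l_coset_bs_A_mult:
  assumes "g \<in> carrier (BS m n)" "u \<in> carrier (BS m n)"
  shows "g <#\<^bsub>BS m n\<^esub> (u <#\<^bsub>BS m n\<^esub> bs_A m n) = (g \<otimes>\<^bsub>BS m n\<^esub> u) <#\<^bsub>BS m n\<^esub> bs_A m n"
  using group.lcos_m_assoc[OF group_BS subgroup.subset[OF subgroup_bs_A]] assms by blast

lemma bs_pi_vertex:
  assumes "g \<in> carrier (BS m n)" "C \<in> bs_vertices m n"
  shows "bs_pi m n g C \<in> bs_vertices m n"
proof -
  interpret group "BS m n" by (rule group_BS)
  show ?thesis
    using assms by (auto simp: bs_pi_def bs_vertices_iff l_coset_bs_A_mult)
qed

lemma bs_pi_inverse: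
  assumes g: "g \<in> carrier (BS m n)" and h: "h \<in> carrier (BS m n)"
    and hg: "h \<otimes>\<^bsub>BS m n\<^esub> g = \<one>\<^bsub>BS m n\<^esub>" and C: "C \<in> bs_vertices m n"
  shows "bs_pi m n h (bs_pi m n g C) = C"
proof -
  interpret group "BS m n" by (rule group_BS)
  obtain u where u: "u \<in> carrier (BS m n)" "C = u <#\<^bsub>BS m n\<^esub> bs_A m n"
    using C by (auto simp: bs_vertices_iff)
  have "h \<otimes>\<^bsub>BS m n\<^esub> (g \<otimes>\<^bsub>BS m n\<^esub> u) = u"
    using g h u(1) hg by (simp add: m_assoc[symmetric])
  then show ?thesis
    using bs_pi_vertex[OF g C] g h u C by (simp add: bs_pi_def l_coset_bs_A_mult)
qed

lemma bs_pi_Bij: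
  assumes g: "g \<in> carrier (BS m n)"
  shows "bs_pi m n g \<in> Bij (bs_vertices m n)"
proof -
  interpret group "BS m n" by (rule group_BS)
  have i: "inv\<^bsub>BS m n\<^esub> g \<in> carrier (BS m n)" using g by simp
  have "bij_betw (bs_pi m n g) (bs_vertices m n) (bs_vertices m n)"
    by (rule bij_betw_byWitness[where f' = "bs_pi m n (inv\<^bsub>BS m n\<^esub> g)"])
      (use bs_pi_vertex[OF g] bs_pi_vertex[OF i] bs_pi_inverse[OF g i] bs_pi_inverse[OF i g] g
       in auto)
  then show ?thesis by (simp add: Bij_def bs_pi_def)
qed

lemma bs_edges_translate:
  assumes g: "g \<in> carrier (BS m n)" and CD: "(C, e, D) \<in> bs_edges m n"
  shows "(bs_pi m n g C, e, bs_pi m n g D) \<in> bs_edges m n"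
proof -
  let ?G = "BS m n" and ?A = "bs_A m n"
  interpret group ?G by (rule group_BS)
  obtain u v i where uv: "u \<in> carrier ?G" "v \<in> carrier ?G" "e \<in> {1, -1}"
    and C: "C = u <#\<^bsub>?G\<^esub> ?A" and D: "D = v <#\<^bsub>?G\<^esub> ?A"
    and D': "D = (u \<otimes>\<^bsub>?G\<^esub> (bs_a m n [^]\<^bsub>?G\<^esub> (i::int)) \<otimes>\<^bsub>?G\<^esub> (bs_t m n [^]\<^bsub>?G\<^esub> e)) <#\<^bsub>?G\<^esub> ?A"
    using CD unfolding bs_edges_def by blast
  have ai: "bs_a m n [^]\<^bsub>?G\<^esub> i \<in> carrier ?G" and te: "bs_t m n [^]\<^bsub>?G\<^esub> e \<in> carrier ?G"
    by (simp_all add: int_pow_closed bs_a_carrier bs_t_carrier)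
  have vert: "C \<in> bs_vertices m n" "D \<in> bs_vertices m n"
    using uv C D by (auto simp: bs_vertices_iff)
  have C1: "bs_pi m n g C = (g \<otimes>\<^bsub>?G\<^esub> u) <#\<^bsub>?G\<^esub> ?A"
    using vert g uv by (simp add: bs_pi_def C l_coset_bs_A_mult)
  have D1: "bs_pi m n g D = (g \<otimes>\<^bsub>?G\<^esub> v) <#\<^bsub>?G\<^esub> ?A"
    using vert g uv by (simp add: bs_pi_def D l_coset_bs_A_mult)
  have "bs_pi m n g D = (g \<otimes>\<^bsub>?G\<^esub> (u \<otimes>\<^bsub>?G\<^esub> (bs_a m n [^]\<^bsub>?G\<^esub> i) \<otimes>\<^bsub>?G\<^esub> (bs_t m n [^]\<^bsub>?G\<^esub> e))) <#\<^bsub>?G\<^esub> ?A"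
    using vert(2) g uv ai te unfolding bs_pi_def by (simp add: D' l_coset_bs_A_mult)
  also have "\<dots> = (g \<otimes>\<^bsub>?G\<^esub> u \<otimes>\<^bsub>?G\<^esub> (bs_a m n [^]\<^bsub>?G\<^esub> i) \<otimes>\<^bsub>?G\<^esub> (bs_t m n [^]\<^bsub>?G\<^esub> e)) <#\<^bsub>?G\<^esub> ?A"
    using g uv ai te by (simp add: m_assoc)
  finally have D2: "(g \<otimes>\<^bsub>?G\<^esub> v) <#\<^bsub>?G\<^esub> ?A = \<dots>" unfolding D1 .
  have "g \<otimes>\<^bsub>?G\<^esub> u \<in> carrier ?G" "g \<otimes>\<^bsub>?G\<^esub> v \<in> carrier ?G" using g uv by simp_all
  then show ?thesis
    unfolding C1 D1 bs_edges_def using uv(3) D2 by blast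
qed

lemma bs_edges_translate_iff:
  assumes g: "g \<in> carrier (BS m n)" and CD: "C \<in> bs_vertices m n" "D \<in> bs_vertices m n"
  shows "(bs_pi m n g C, e, bs_pi m n g D) \<in> bs_edges m n \<longleftrightarrow> (C, e, D) \<in> bs_edges m n"
proof
  interpret group "BS m n" by (rule group_BS)
  have i: "inv\<^bsub>BS m n\<^esub> g \<in> carrier (BS m n)" using g by simp
  assume "(bs_pi m n g C, e, bs_pi m n g D) \<in> bs_edges m n"
  from bs_edges_translate[OF i this] show "(C, e, D) \<in> bs_edges m n"
    using g CD by (simp add: bs_pi_inverse[OF g i])
qed (rule bs_edges_translate[OF g])


section \<open>The closure in the automorphism group\<close>

lemma bs_G_subset_Bij: "bs_G m n \<subseteq> Bij (bs_vertices m n)"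
  using closure_of_subset_topspace[of "bs_Sym_topology m n" "bs_image m n"]
  by (simp add: bs_G_def bs_Sym_topology_def topspace_perm_topology)

lemma bs_image_subset_G: "bs_image m n \<subseteq> bs_G m n"
  unfolding bs_G_def
  by (rule closure_of_subset)
    (auto simp: bs_Sym_topology_def topspace_perm_topology bs_image_def bs_pi_Bij)

lemma bs_G_edges_iff:
  assumes "f \<in> bs_G m n" "C \<in> bs_vertices m n" "D \<in> bs_vertices m n"
  shows "(f C, e, f D) \<in> bs_edges m n \<longleftrightarrow> (C, e, D) \<in> bs_edges m n"
  by (rule closure_of_preserves[where E = "\<lambda>C D. (C, e, D) \<in> bs_edges m n",
        OF assms(1)[unfolded bs_G_def bs_Sym_topology_def]])
    (use assms bs_edges_translate_iff in \<open>auto simp: bs_image_def\<close>)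

lemma bs_G_subset_label_Aut: "bs_G m n \<subseteq> bs_tree_label_Aut m n"
  using bs_G_subset_Bij by (auto simp: bs_tree_label_Aut_def bs_G_edges_iff)

lemma bs_tree_label_Aut_subset_Aut: "bs_tree_label_Aut m n \<subseteq> bs_tree_Aut m n"
  by (auto simp: bs_tree_label_Aut_def bs_tree_Aut_def bs_adj_def)

theorem mainTheorem5:
  fixes m n :: int
  assumes "m \<noteq> 0" and "n \<noteq> 0"
  shows "\<forall>Aut_T \<in> {bs_tree_Aut m n, bs_tree_label_Aut m n}.
    bs_image m n \<subseteq> Aut_T \<and>
    perm_topology (bs_vertices m n) Aut_T closure_of bs_image m n = bs_G m n \<and>
    subtopology (perm_topology (bs_vertices m n) Aut_T)
      (perm_topology (bs_vertices m n) Aut_T closure_of bs_image m n) = bs_G_topology m n"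
proof
  fix Aut_T assume "Aut_T \<in> {bs_tree_Aut m n, bs_tree_label_Aut m n}"
  then have Aut: "Aut_T = bs_tree_Aut m n \<or> Aut_T = bs_tree_label_Aut m n" by simp
  then have Bij: "Aut_T \<subseteq> Bij (bs_vertices m n)"
    by (auto simp: bs_tree_Aut_def bs_tree_label_Aut_def)
  have G: "bs_G m n \<subseteq> Aut_T"
    using Aut bs_G_subset_label_Aut[of m n] bs_tree_label_Aut_subset_Aut[of m n] by blast
  have im: "bs_image m n \<subseteq> Aut_T" using bs_image_subset_G G by blast
  note eq = closure_perm_topology_eq[OF Bij G[unfolded bs_G_def bs_Sym_topology_def] im]
  show "bs_image m n \<subseteq> Aut_T \<and>
    perm_topology (bs_vertices m n) Aut_T closure_of bs_image m n = bs_G m n \<and>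
    subtopology (perm_topology (bs_vertices m n) Aut_T)
      (perm_topology (bs_vertices m n) Aut_T closure_of bs_image m n) = bs_G_topology m n"
    using im by (simp add: eq bs_G_topology_def bs_G_def bs_Sym_topology_def)
qed

end
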